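(* Let $X_1,\dots,X_n$ be nonnegative random variables on a probability space $(\Omega,\mathcal F,\mathbb P)$, let $S=\sum_{j=1}^n X_j$, and let $\mu_S$ be the law of $S$. For $i\in\{1,\dots,n\}$ let $\nu_i(B)=\mathbb E[X_i\mathbf 1_{\{S\in B\}}]$ for Borel $B\subseteq[0,\infty)$, and let $\mathcal L_{\boldsymbol X}(t_1,\dots,t_n)=\mathbb E\big[e^{-\sum_{j=1}^n t_jX_j}\big]$ for $(t_1,\dots,t_n)\in[0,\infty)^n$. Then, for each $i\in\{1,\dots,n\}$, the following hold. (i) For any $(t_1,\dots,t_n)\in[0,\infty)^n$ with $t_i>0$, the partial derivative $\frac{\partial}{\partial t_i}\mathcal L_{\boldsymbol X}(t_1,\dots,t_n)$ exists as a two-sided derivative and satisfies $$\frac{\partial}{\partial t_i}\mathcal L_{\boldsymbol X}(t_1,\dots,t_n)=-\mathbb E\Big[X_ie^{-\sum_{j=1}^n t_jX_j}\Big].$$ If $t_i=0$, the right derivative exists (possibly equal to $-\infty$). In particular, defining along the diagonal $$\mathcal L_i^*(t):=-\left.\frac{\partial}{\partial t_i}\mathcal L_{\boldsymbol X}(t_1,\dots,t_n)\right|_{t_1=\cdots=t_n=t},\qquad t\ge 0$$ (right derivative at $t=0$), one has $\mathcal L_i^*(0)=\mathbb E[X_i]$ (possibly $+\infty$) and $\mathcal L_i^*(t)=\mathbb E[X_ie^{-tS}]$ for all $t>0$. (ii) Let $m_i:=\frac{\mathrm d\nu_i}{\mathrm d\mu_S}$ be the Radon--Nikodym derivative of $\nu_i$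 with respect to $\mu_S$. Then $m_i(S)$ coincides almost surely with $\mathbb E[X_i\mid S]$. Also, $\mathbb E[X_i\mid S=s]=m_i(s)$ for $\mu_S$-almost every $s$. (iii) If $S$ admits a density $f_S$ with respect to Lebesgue measure and $\xi_i$ denotes the Lebesgue density of $\nu_i$, then for Lebesgue-almost every $s>0$, $$\xi_i(s)=\mathbb E[X_i\mid S=s]\,f_S(s),$$ and $\mathcal L_i^*$ is the Laplace transform of $\xi_i$: $$\mathcal L_i^*(t)=\int_0^\infty e^{-ts}\xi_i(s)\,\mathrm ds,\qquad t>0.$$
   Context: No moment assumption is made on the $X_i$: $\mathbb E[X_i]$ may be $+\infty$. The measure $\nu_i$ is a $\sigma$-finite Borel measure on $[0,\infty)$ (indeed $\nu_i([0,s])\le s$ for each $s\ge 0$), and it is absolutely continuous with respect to $\mu_S$, so $m_i$ exists. The conditional expectation $\mathbb E[X_i\mid S]$ of the nonnegative variable $X_i$ is the ($\mu_S$-a.e. unique) $\sigma(S)$-measurable nonnegative variable $Y$ with $\mathbb E[\varphi(S)X_i]=\mathbb E[\varphi(S)Y]$ for all bounded nonnegative measurable $\varphi$; $s\mapsto\mathbb E[X_i\mid S=s]$ denotes a measurable function $g$ with $g(S)=\mathbb E[X_i\mid S]$ a.s. *)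

theory Defs
  imports "HOL-Probability.Probability"
begin

definition rv_sum :: "nat \<Rightarrow> (nat \<Rightarrow> 'a \<Rightarrow> real) \<Rightarrow> 'a \<Rightarrow> real" where
  "rv_sum n X \<omega> = (\<Sum>j=1..n. X j \<omega>)"

text \<open>Measures on the half-line are represented as measures on the Borel sets of the real line;
  for nonnegative variables the negative half-line is a null set of both measures below.\<close>

definition law_sum :: "'a measure \<Rightarrow> nat \<Rightarrow> (nat \<Rightarrow> 'a \<Rightarrow> real) \<Rightarrow> real measure" where
  "law_sum M n X = distr M borel (rv_sum n X)"

definition alloc_measure :: "'a measure \<Rightarrow> nat \<Rightarrow> (nat \<Rightarrow> 'a \<Rightarrow> real) \<Rightarrow> nat \<Rightarrow> real measure" where
  "alloc_measure M n X i =
     measure_of UNIV (sets borel)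
       (\<lambda>B. \<integral>\<^sup>+\<omega>. ennreal (X i \<omega>) * indicator B (rv_sum n X \<omega>) \<partial>M)"

text \<open>Only the coordinates with index in \<open>{1..n}\<close> of the argument \<open>t\<close> are used.\<close>

definition joint_laplace :: "'a measure \<Rightarrow> nat \<Rightarrow> (nat \<Rightarrow> 'a \<Rightarrow> real) \<Rightarrow> (nat \<Rightarrow> real) \<Rightarrow> real" where
  "joint_laplace M n X t = (\<integral>\<omega>. exp (- (\<Sum>j=1..n. t j * X j \<omega>)) \<partial>M)"

definition has_right_derivative_ext :: "(real \<Rightarrow> real) \<Rightarrow> ereal \<Rightarrow> real \<Rightarrow> bool" where
  "has_right_derivative_ext f D x \<longleftrightarrow>
     ((\<lambda>y. ereal ((f y - f x) / (y - x))) \<longlongrightarrow> D) (at_right x)"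

definition right_derivative_ext :: "(real \<Rightarrow> real) \<Rightarrow> real \<Rightarrow> ereal" where
  "right_derivative_ext f x = (THE D. has_right_derivative_ext f D x)"

text \<open>Minus the \<open>i\<close>-th partial derivative on the diagonal point \<open>(t, \<dots>, t)\<close>; it is extended-real
  valued because the right derivative at \<open>t = 0\<close> may be infinite. Meaningful for \<open>t \<ge> 0\<close> only.\<close>

definition diag_laplace :: "'a measure \<Rightarrow> nat \<Rightarrow> (nat \<Rightarrow> 'a \<Rightarrow> real) \<Rightarrow> nat \<Rightarrow> real \<Rightarrow> ereal" where
  "diag_laplace M n X i t =
     (let f = (\<lambda>x. joint_laplace M n X ((\<lambda>j. t)(i := x)))
      in if t = 0 then - right_derivative_ext f 0 else - ereal (deriv f t))"

text \<open>The expectation of \<open>f\<close> given the sigma-algebra generated by \<open>Y\<close>, for nonnegative and possibly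
  non-integrable \<open>f\<close>; hence the ennreal-valued version.\<close>

definition cond_exp_given :: "'a measure \<Rightarrow> ('a \<Rightarrow> real) \<Rightarrow> ('a \<Rightarrow> real) \<Rightarrow> 'a \<Rightarrow> ennreal" where
  "cond_exp_given M f Y =
     nn_cond_exp M (vimage_algebra (space M) Y borel) (\<lambda>\<omega>. ennreal (f \<omega>))"

text \<open>\<open>g\<close> is a version of the function mapping \<open>s\<close> to the expectation of \<open>f\<close> given \<open>Y = s\<close>.\<close>

definition cond_exp_at_version ::
    "'a measure \<Rightarrow> ('a \<Rightarrow> real) \<Rightarrow> ('a \<Rightarrow> real) \<Rightarrow> (real \<Rightarrow> ennreal) \<Rightarrow> bool" where
  "cond_exp_at_version M f Y g \<longleftrightarrow>
     g \<in> borel_measurable borel \<and> (AE \<omega> in M. g (Y \<omega>) = cond_exp_given M f Y \<omega>)"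

definition is_density_of :: "'b measure \<Rightarrow> 'b measure \<Rightarrow> ('b \<Rightarrow> ennreal) \<Rightarrow> bool" where
  "is_density_of N M f \<longleftrightarrow> f \<in> borel_measurable M \<and> density M f = N"

lemma rv_sum_measurable:
  assumes "\<And>j. j \<in> {1..n} \<Longrightarrow> X j \<in> borel_measurable M"
  shows "rv_sum n X \<in> borel_measurable M"
  unfolding rv_sum_def using assms by (intro borel_measurable_sum)

lemma alloc_measure_eq_distr:
  assumes "\<And>j. j \<in> {1..n} \<Longrightarrow> X j \<in> borel_measurable M" and "i \<in> {1..n}"
  shows "alloc_measure M n X i = distr (density M (\<lambda>\<omega>. ennreal (X i \<omega>))) borel (rv_sum n X)"
    (is "_ = ?D")
proof -
  have [measurable]: "X i \<in> borel_measurable M" "rv_sum n X \<in> borel_measurable M"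
    using assms rv_sum_measurable by blast+
  have eq: "(\<integral>\<^sup>+\<omega>. ennreal (X i \<omega>) * indicator B (rv_sum n X \<omega>) \<partial>M) = emeasure ?D B"
    if [measurable]: "B \<in> sets borel" for B
    by (subst emeasure_distr, simp, simp, subst emeasure_density)
       (auto intro!: nn_integral_cong simp: indicator_def)
  have "?D = measure_of (space ?D) (sets ?D) (emeasure ?D)"
    by (simp only: measure_of_of_measure)
  also have "\<dots> = alloc_measure M n X i"
    unfolding alloc_measure_def
    by (auto intro!: measure_of_eq simp: eq sigma_algebra.sigma_sets_eq[OF sets.sigma_algebra_axioms[of borel], simplified])
  finally show ?thesis ..
qed

lemma emeasure_alloc_measure:
  assumes "\<And>j. j \<in> {1..n} \<Longrightarrow> X j \<in> borel_measurable M" and "i \<in> {1..n}"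
    and "B \<in> sets borel"
  shows "emeasure (alloc_measure M n X i) B =
           (\<integral>\<^sup>+\<omega>. ennreal (X i \<omega>) * indicator B (rv_sum n X \<omega>) \<partial>M)"
proof -
  have [measurable]: "X i \<in> borel_measurable M" "rv_sum n X \<in> borel_measurable M"
    using assms rv_sum_measurable by blast+
  have [measurable]: "B \<in> sets borel" by fact
  have "alloc_measure M n X i = distr (density M (\<lambda>\<omega>. ennreal (X i \<omega>))) borel (rv_sum n X)"
    using assms by (intro alloc_measure_eq_distr)
  then show ?thesis
    by (simp only:)
       (subst emeasure_distr, simp, simp, subst emeasure_density,
        auto intro!: nn_integral_cong simp: indicator_def)
qed

lemma cond_exp_given_charact:
  assumes "prob_space M" and [measurable]: "f \<in> borel_measurable M" "Y \<in> borel_measurable M"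
  shows "cond_exp_given M f Y \<in> borel_measurable (vimage_algebra (space M) Y borel)"
    and "\<phi> \<in> borel_measurable borel \<Longrightarrow>
      (\<integral>\<^sup>+\<omega>. \<phi> (Y \<omega>) * cond_exp_given M f Y \<omega> \<partial>M) = (\<integral>\<^sup>+\<omega>. \<phi> (Y \<omega>) * ennreal (f \<omega>) \<partial>M)"
proof -
  interpret prob_space M by fact
  let ?F = "vimage_algebra (space M) Y borel"
  have sub: "subalgebra M ?F"
    unfolding subalgebra_def
    by (auto simp: sets_vimage_algebra2 intro!: measurable_sets[OF assms(3)])
  interpret finite_measure_subalgebra M ?F
    by unfold_locales (rule sub)
  show "cond_exp_given M f Y \<in> borel_measurable ?F"
    unfolding cond_exp_given_def by simp
  assume [measurable]: "\<phi> \<in> borel_measurable borel"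
  have "Y \<in> measurable ?F borel"
    by (rule measurable_vimage_algebra1) auto
  then have [measurable]: "(\<lambda>\<omega>. \<phi> (Y \<omega>)) \<in> borel_measurable ?F" by measurable
  show "(\<integral>\<^sup>+\<omega>. \<phi> (Y \<omega>) * cond_exp_given M f Y \<omega> \<partial>M) = (\<integral>\<^sup>+\<omega>. \<phi> (Y \<omega>) * ennreal (f \<omega>) \<partial>M)"
    unfolding cond_exp_given_def by (rule nn_cond_exp_intg) auto
qed

end

theory Submission
  imports Defs
begin

text \<open>Fixing all coordinates but the \<open>i\<close>-th, the joint transform is \<open>x \<mapsto> E[W exp (- x X\<^sub>i)]\<close>
  with a weight \<open>0 \<le> W \<le> 1\<close>. For \<open>x > 0\<close> the difference quotients are dominated by the constant
  \<open>2 / x\<close>, because \<open>a exp (- c a) \<le> 1 / c\<close>; at \<open>x = 0\<close> they are bounded by the possibly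
  non-integrable limit, which together with Fatou's lemma still gives convergence.
  For the second part, a density \<open>m\<close> of the allocation measure satisfies the defining property of the
  conditional expectation by change of variables. The third part follows from the uniqueness of
  Lebesgue densities, since \<open>f\<^sub>S m\<close> is a density of the allocation measure.\<close>

section \<open>Elementary bounds for decaying exponentials\<close>

lemma abs_exp_diff_le:
  fixes a c x y :: real
  assumes "0 \<le> a" "c \<le> x" "c \<le> y"
  shows "\<bar>exp (- (y * a)) - exp (- (x * a))\<bar> \<le> a * exp (- (c * a)) * \<bar>y - x\<bar>"
proof -
  \<comment> \<open>The claim is symmetric in \<open>x\<close> and \<open>y\<close>, so the case
    \<open>x <= y\<close> suffices. Factoring out the larger exponential leaves
    \<open>1 - exp (- ((y - x) * a))\<close>, which is at most \<open>(y - x) * a\<close>.\<close>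
  have *: "\<bar>exp (- (y * a)) - exp (- (x * a))\<bar> \<le> a * exp (- (c * a)) * \<bar>y - x\<bar>"
    if "x \<le> y" "c \<le> x" for x y :: real
  proof -
    have "exp (- (y * a)) = exp (- (x * a)) * exp (- ((y - x) * a))"
      by (simp add: exp_add[symmetric] algebra_simps)
    moreover have "exp (- (x * a)) \<le> exp (- (c * a))"
      using that assms by (simp add: mult_right_mono)
    moreover have "1 - exp (- ((y - x) * a)) \<le> (y - x) * a"
      using exp_ge_add_one_self[of "- ((y - x) * a)"] by simp
    moreover have "exp (- ((y - x) * a)) \<le> 1"
      using that assms by simp
    ultimately have "\<bar>exp (- (y * a)) - exp (- (x * a))\<bar>
        = exp (- (x * a)) * (1 - exp (- ((y - x) * a)))"
      by (simp add: abs_if algebra_simps)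
    also have "\<dots> \<le> exp (- (c * a)) * ((y - x) * a)"
      using \<open>exp (- (x * a)) \<le> exp (- (c * a))\<close> \<open>1 - exp (- ((y - x) * a)) \<le> (y - x) * a\<close>
        \<open>exp (- ((y - x) * a)) \<le> 1\<close>
      by (intro mult_mono) auto
    finally show ?thesis
      using that by (simp add: mult_ac)
  qed
  show ?thesis
    using *[of x y] *[of y x] assms by (cases "x \<le> y") (auto simp: abs_minus_commute)
qed

text \<open>This is \<open>u <= exp u\<close> at \<open>u = c * a\<close>. The bound is uniform in
  \<open>a\<close>, so a random variable put in place of \<open>a\<close> yields a bounded integrand
  whatever its moments are.\<close>

lemma mult_exp_neg_le:
  fixes a c :: real
  assumes "0 < c"
  shows "a * exp (- (c * a)) \<le> 1 / c"
proof -
  have "c * a \<le> exp (c * a)"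
    using exp_ge_add_one_self[of "c * a"] by linarith
  then have "c * a * exp (- (c * a)) \<le> 1"
    by (simp add: exp_minus field_simps)
  then show ?thesis
    using assms by (simp add: field_simps)
qed

text \<open>The derivative is put in sequential form because dominated convergence and Fatou's lemma
  are applied along sequences.\<close>

lemma exp_neg_difference_quotient_LIMSEQ:
  fixes a x :: real
  assumes "\<And>k. Y k \<noteq> x" "Y \<longlonglongrightarrow> x"
  shows "(\<lambda>k. (exp (- (Y k * a)) - exp (- (x * a))) / (Y k - x)) \<longlonglongrightarrow> - (a * exp (- (x * a)))"
proof -
  have "((\<lambda>y. exp (- (y * a))) has_real_derivative - (a * exp (- (x * a)))) (at x)"
    by (auto intro!: derivative_eq_intros)
  then show ?thesis
    using assms unfolding has_field_derivative_iff tendsto_at_iff_sequentially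
    by (auto simp: comp_def)
qed

section \<open>One-variable Laplace transforms with a bounded weight\<close>

context prob_space
begin

text \<open>The integrands are bounded by 1 and by \<open>1 / x\<close>, and bounded measurable
  functions are integrable for a probability measure. The second bound degenerates at
  \<open>x = 0\<close>, hence the strict inequality.\<close>

lemma integrable_mult_exp_neg:
  fixes W Z :: "'a \<Rightarrow> real" and x :: real
  assumes [measurable]: "W \<in> borel_measurable M" "Z \<in> borel_measurable M"
    and "\<And>\<omega>. \<omega> \<in> space M \<Longrightarrow> 0 \<le> W \<omega> \<and> W \<omega> \<le> 1" "\<And>\<omega>. \<omega> \<in> space M \<Longrightarrow> 0 \<le> Z \<omega>"
  shows "0 \<le> x \<Longrightarrow> integrable M (\<lambda>\<omega>. W \<omega> * exp (- (x * Z \<omega>)))"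
    and "0 < x \<Longrightarrow> integrable M (\<lambda>\<omega>. W \<omega> * (Z \<omega> * exp (- (x * Z \<omega>))))"
proof -
  assume "0 \<le> x"
  then show "integrable M (\<lambda>\<omega>. W \<omega> * exp (- (x * Z \<omega>)))"
    using assms(3,4)
    by (intro integrable_const_bound[where B=1] AE_I2) (auto intro!: mult_le_one)
next
  assume "0 < x"
  have "norm (W \<omega> * (Z \<omega> * exp (- (x * Z \<omega>)))) \<le> 1 / x" if "\<omega> \<in> space M" for \<omega>
    using mult_mono[OF _ mult_exp_neg_le[OF \<open>0 < x\<close>, of "Z \<omega>"], of "W \<omega>" 1]
      assms(3,4)[OF that] by (simp add: abs_mult)
  then show "integrable M (\<lambda>\<omega>. W \<omega> * (Z \<omega> * exp (- (x * Z \<omega>))))"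
    by (intro integrable_const_bound[where B="1 / x"] AE_I2) auto
qed

text \<open>Differentiation under the integral sign: dominated convergence along an arbitrary
  sequence tending to \<open>x\<close> from either side.\<close>

lemma has_real_derivative_weighted_laplace:
  fixes W Z :: "'a \<Rightarrow> real" and x :: real
  assumes [measurable]: "W \<in> borel_measurable M" "Z \<in> borel_measurable M"
    and W: "\<And>\<omega>. \<omega> \<in> space M \<Longrightarrow> 0 \<le> W \<omega> \<and> W \<omega> \<le> 1"
    and Z: "\<And>\<omega>. \<omega> \<in> space M \<Longrightarrow> 0 \<le> Z \<omega>"
    and x: "0 < x"
  shows "((\<lambda>x. \<integral>\<omega>. W \<omega> * exp (- (x * Z \<omega>)) \<partial>M) has_real_derivative
           - (\<integral>\<omega>. W \<omega> * (Z \<omega> * exp (- (x * Z \<omega>))) \<partial>M)) (at x)"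
  unfolding has_field_derivative_iff tendsto_at_iff_sequentially comp_def
proof (intro allI impI)
  let ?F = "\<lambda>x. \<integral>\<omega>. W \<omega> * exp (- (x * Z \<omega>)) \<partial>M"
  let ?q = "\<lambda>y \<omega>. W \<omega> * ((exp (- (y * Z \<omega>)) - exp (- (x * Z \<omega>))) / (y - x))"
  fix Y assume "\<forall>k. Y k \<in> UNIV - {x}" and lim: "Y \<longlonglongrightarrow> x"
  then have ne: "Y k \<noteq> x" for k by simp
  \<comment> \<open>On this tail both \<open>Y k\<close> and \<open>x\<close> exceed
    \<open>x / 2\<close>, so \<open>c = x / 2\<close> in the exponential bounds gives the dominating
    constant \<open>2 / x\<close>. The sequence is therefore shifted by \<open>N\<close>, and
    \<open>LIMSEQ_offset\<close> undoes the shift at the end.\<close>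
  have "eventually (\<lambda>k. x / 2 < Y k) sequentially"
    using lim x by (intro order_tendstoD(1)[OF lim]) simp
  then obtain N where N: "\<And>k. N \<le> k \<Longrightarrow> x / 2 < Y k"
    by (auto simp: eventually_sequentially)
  have bound: "norm (?q y \<omega>) \<le> 2 / x" if "x / 2 < y" "y \<noteq> x" "\<omega> \<in> space M" for y \<omega>
  proof -
    have "\<bar>exp (- (y * Z \<omega>)) - exp (- (x * Z \<omega>))\<bar> \<le> Z \<omega> * exp (- (x / 2 * Z \<omega>)) * \<bar>y - x\<bar>"
      using that x Z by (intro abs_exp_diff_le) auto
    also have "\<dots> \<le> 1 / (x / 2) * \<bar>y - x\<bar>"
      using x by (intro mult_right_mono mult_exp_neg_le) auto
    finally have "\<bar>(exp (- (y * Z \<omega>)) - exp (- (x * Z \<omega>))) / (y - x)\<bar> \<le> 2 / x"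
      using that by (simp add: abs_divide field_simps)
    from mult_mono[OF _ this, of "W \<omega>" 1] show ?thesis
      using W[OF that(3)] by (simp add: abs_mult)
  qed
  have "(\<lambda>k. \<integral>\<omega>. ?q (Y (k + N)) \<omega> \<partial>M) \<longlonglongrightarrow> (\<integral>\<omega>. W \<omega> * - (Z \<omega> * exp (- (x * Z \<omega>))) \<partial>M)"
  proof (rule integral_dominated_convergence)
    have "(\<lambda>k. Y (k + N)) \<longlonglongrightarrow> x"
      using lim by (rule LIMSEQ_ignore_initial_segment)
    then show "AE \<omega> in M. (\<lambda>k. ?q (Y (k + N)) \<omega>) \<longlonglongrightarrow> W \<omega> * - (Z \<omega> * exp (- (x * Z \<omega>)))"
      using ne by (intro AE_I2 tendsto_mult_left exp_neg_difference_quotient_LIMSEQ)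
    show "AE \<omega> in M. norm (?q (Y (k + N)) \<omega>) \<le> 2 / x" for k
      using N[of "k + N"] ne by (intro AE_I2 bound) auto
  qed auto
  also have "(\<lambda>k. \<integral>\<omega>. ?q (Y (k + N)) \<omega> \<partial>M) = (\<lambda>k. (?F (Y (k + N)) - ?F x) / (Y (k + N) - x))"
  proof
    fix k
    \<comment> \<open>Splitting the integral of the difference requires both terms to be integrable;
      the shift by \<open>N\<close> ensures that \<open>Y (k + N)\<close> is positive.\<close>
    have int: "integrable M (\<lambda>\<omega>. W \<omega> * exp (- (Y (k + N) * Z \<omega>)))"
        "integrable M (\<lambda>\<omega>. W \<omega> * exp (- (x * Z \<omega>)))"
      using x N[of "k + N"] W Z by (intro integrable_mult_exp_neg(1); simp)+
    have "?q (Y (k + N)) = (\<lambda>\<omega>. (W \<omega> * exp (- (Y (k + N) * Z \<omega>))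
        - W \<omega> * exp (- (x * Z \<omega>))) / (Y (k + N) - x))"
      by (simp add: right_diff_distrib)
    then show "(\<integral>\<omega>. ?q (Y (k + N)) \<omega> \<partial>M) = (?F (Y (k + N)) - ?F x) / (Y (k + N) - x)"
      using int by simp
  qed
  finally have "(\<lambda>k. (?F (Y (k + N)) - ?F x) / (Y (k + N) - x))
      \<longlonglongrightarrow> - (\<integral>\<omega>. W \<omega> * (Z \<omega> * exp (- (x * Z \<omega>))) \<partial>M)"
    by simp
  then show "(\<lambda>k. (?F (Y k) - ?F x) / (Y k - x))
      \<longlonglongrightarrow> - (\<integral>\<omega>. W \<omega> * (Z \<omega> * exp (- (x * Z \<omega>))) \<partial>M)"
    by (rule LIMSEQ_offset)
qed

text \<open>Since \<open>W * Z\<close> may have infinite integral, the limit is written with a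
  nonnegative integral, which treats the finite and the infinite case at once.\<close>

lemma has_right_derivative_ext_weighted_laplace:
  fixes W Z :: "'a \<Rightarrow> real"
  assumes [measurable]: "W \<in> borel_measurable M" "Z \<in> borel_measurable M"
    and W: "\<And>\<omega>. \<omega> \<in> space M \<Longrightarrow> 0 \<le> W \<omega> \<and> W \<omega> \<le> 1"
    and Z: "\<And>\<omega>. \<omega> \<in> space M \<Longrightarrow> 0 \<le> Z \<omega>"
  shows "has_right_derivative_ext (\<lambda>x. \<integral>\<omega>. W \<omega> * exp (- (x * Z \<omega>)) \<partial>M)
           (- enn2ereal (\<integral>\<^sup>+\<omega>. ennreal (W \<omega> * Z \<omega>) \<partial>M)) 0"
  unfolding has_right_derivative_ext_def tendsto_at_iff_sequentially comp_def
proof (intro allI impI)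
  let ?F = "\<lambda>x. \<integral>\<omega>. W \<omega> * exp (- (x * Z \<omega>)) \<partial>M"
  \<comment> \<open>This is minus the difference quotient of the integrand: the sign makes it
    nonnegative, as Fatou's lemma requires. \<open>q_int\<close> restores the sign.\<close>
  let ?q = "\<lambda>y \<omega>. W \<omega> * ((1 - exp (- (y * Z \<omega>))) / y)"
  fix Y :: "nat \<Rightarrow> real" assume "\<forall>k. Y k \<in> {0<..} - {0}" and lim: "Y \<longlonglongrightarrow> 0"
  then have pos: "0 < Y k" for k by auto
  have q_nonneg: "0 \<le> ?q (Y k) \<omega>" if "\<omega> \<in> space M" for k \<omega>
    using W[OF that] Z[OF that] pos[of k] by simp
  have q_le: "?q (Y k) \<omega> \<le> W \<omega> * Z \<omega>" if "\<omega> \<in> space M" for k \<omega>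
    using W[OF that] pos[of k] exp_ge_add_one_self[of "- (Y k * Z \<omega>)"]
    by (intro mult_left_mono) (auto simp: field_simps)
  have q_lim: "(\<lambda>k. ?q (Y k) \<omega>) \<longlonglongrightarrow> W \<omega> * Z \<omega>" for \<omega>
  proof -
    have ne: "Y k \<noteq> 0" for k using pos[of k] by simp
    have "(\<lambda>k. - ((exp (- (Y k * Z \<omega>)) - exp (- (0 * Z \<omega>))) / (Y k - 0)))
        \<longlonglongrightarrow> - (- (Z \<omega> * exp (- (0 * Z \<omega>))))"
      by (intro tendsto_minus exp_neg_difference_quotient_LIMSEQ ne lim)
    then show ?thesis
      by (intro tendsto_mult_left) (simp add: minus_divide_left)
  qed
  \<comment> \<open>For fixed \<open>k\<close> the quotient is integrable, so the Bochner and the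
    nonnegative integral agree; only the limit can be infinite.\<close>
  have q_int: "ereal ((?F (Y k) - ?F 0) / (Y k - 0)) = - enn2ereal (\<integral>\<^sup>+\<omega>. ennreal (?q (Y k) \<omega>) \<partial>M)"
    for k
  proof -
    have int: "integrable M (\<lambda>\<omega>. W \<omega> * exp (- (Y k * Z \<omega>)))" "integrable M W"
      using integrable_mult_exp_neg(1)[of W Z, OF _ _ W Z, of "Y k"]
        integrable_mult_exp_neg(1)[of W Z, OF _ _ W Z, of 0] pos[of k] by auto
    have q: "?q (Y k) = (\<lambda>\<omega>. (W \<omega> - W \<omega> * exp (- (Y k * Z \<omega>))) / Y k)"
      by (auto simp: right_diff_distrib)
    have "integrable M (?q (Y k))"
      unfolding q using int by auto
    then have "(\<integral>\<^sup>+\<omega>. ennreal (?q (Y k) \<omega>) \<partial>M) = ennreal (\<integral>\<omega>. ?q (Y k) \<omega> \<partial>M)"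
      using q_nonneg by (intro nn_integral_eq_integral AE_I2) auto
    moreover have "0 \<le> (\<integral>\<omega>. ?q (Y k) \<omega> \<partial>M)"
      using q_nonneg by (intro integral_nonneg_AE AE_I2) auto
    moreover have "(?F (Y k) - ?F 0) / (Y k - 0) = - (\<integral>\<omega>. ?q (Y k) \<omega> \<partial>M)"
      unfolding q using int by (simp add: minus_divide_left)
    ultimately show ?thesis
      by (simp only: enn2ereal_ennreal) simp
  qed
  text \<open>The quotients need not be monotone along \<open>Y\<close>; Fatou's lemma together with the bound
    \<open>q_le\<close> replaces monotone convergence.\<close>
  have "(\<integral>\<^sup>+\<omega>. ennreal (W \<omega> * Z \<omega>) \<partial>M) = (\<integral>\<^sup>+\<omega>. liminf (\<lambda>k. ennreal (?q (Y k) \<omega>)) \<partial>M)"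
    using q_lim by (intro nn_integral_cong lim_imp_Liminf[symmetric] tendsto_ennrealI) auto
  also have "\<dots> \<le> liminf (\<lambda>k. \<integral>\<^sup>+\<omega>. ennreal (?q (Y k) \<omega>) \<partial>M)"
    by (intro nn_integral_liminf) measurable
  finally have lower: "(\<integral>\<^sup>+\<omega>. ennreal (W \<omega> * Z \<omega>) \<partial>M) \<le> \<dots>" .
  have upper: "(\<integral>\<^sup>+\<omega>. ennreal (?q (Y k) \<omega>) \<partial>M) \<le> (\<integral>\<^sup>+\<omega>. ennreal (W \<omega> * Z \<omega>) \<partial>M)" for k
    using q_le by (intro nn_integral_mono ennreal_leI) auto
  have "(\<lambda>k. \<integral>\<^sup>+\<omega>. ennreal (?q (Y k) \<omega>) \<partial>M) \<longlonglongrightarrow> (\<integral>\<^sup>+\<omega>. ennreal (W \<omega> * Z \<omega>) \<partial>M)"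
  proof (rule Liminf_eq_Limsup)
    let ?I = "\<integral>\<^sup>+\<omega>. ennreal (W \<omega> * Z \<omega>) \<partial>M"
    let ?L = "\<lambda>k. \<integral>\<^sup>+\<omega>. ennreal (?q (Y k) \<omega>) \<partial>M"
    have "limsup ?L \<le> ?I"
      using upper by (intro Limsup_bounded always_eventually) auto
    moreover have "liminf ?L \<le> limsup ?L"
      by (rule Liminf_le_Limsup) simp
    ultimately show "liminf ?L = ?I" "limsup ?L = ?I"
      using lower by auto
  qed simp
  then show "(\<lambda>k. ereal ((?F (Y k) - ?F 0) / (Y k - 0)))
      \<longlonglongrightarrow> - enn2ereal (\<integral>\<^sup>+\<omega>. ennreal (W \<omega> * Z \<omega>) \<partial>M)"
    unfolding q_int by (intro tendsto_uminus_ereal tendsto_enn2erealI)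
qed

end

text \<open>The description operator has a unique witness: limits in the extended reals are unique,
  and the right neighbourhood filter is nontrivial.\<close>

lemma right_derivative_ext_eqI:
  assumes "has_right_derivative_ext f D x"
  shows "right_derivative_ext f x = D"
  unfolding right_derivative_ext_def
proof (rule the_equality, rule assms)
  fix D' assume "has_right_derivative_ext f D' x"
  then show "D' = D"
    using assms unfolding has_right_derivative_ext_def
    by (rule tendsto_unique[OF trivial_limit_at_right_real])
qed

section \<open>Reduction of the joint transform to a single coordinate\<close>

locale nonneg_summands = prob_space M for M :: "'a measure" +
  fixes n i :: nat and X :: "nat \<Rightarrow> 'a \<Rightarrow> real"
  assumes measurable_X: "j \<in> {1..n} \<Longrightarrow> X j \<in> borel_measurable M"
    and nonneg_X: "j \<in> {1..n} \<Longrightarrow> \<omega> \<in> space M \<Longrightarrow> 0 \<le> X j \<omega>"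
    and i: "i \<in> {1..n}"
begin

lemma measurable_Xi [measurable]: "X i \<in> borel_measurable M"
  using measurable_X i .

lemma measurable_rv_sum [measurable]: "rv_sum n X \<in> borel_measurable M"
  using measurable_X by (rule rv_sum_measurable)

lemma rv_sum_nonneg: "\<omega> \<in> space M \<Longrightarrow> 0 \<le> rv_sum n X \<omega>"
  unfolding rv_sum_def using nonneg_X by (intro sum_nonneg) auto

text \<open>This is the weight \<open>W\<close> of the one-variable lemmas. It does not depend on
  \<open>t i\<close>, so it stays fixed while that coordinate varies.\<close>

definition other_factor :: "(nat \<Rightarrow> real) \<Rightarrow> 'a \<Rightarrow> real" where
  "other_factor t \<omega> = exp (- (\<Sum>j\<in>{1..n} - {i}. t j * X j \<omega>))"

lemma measurable_other_factor [measurable]: "other_factor t \<in> borel_measurable M"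
  unfolding other_factor_def[abs_def] using measurable_X by measurable

lemma other_factor_bounds:
  assumes "\<And>j. j \<in> {1..n} - {i} \<Longrightarrow> 0 \<le> t j" "\<omega> \<in> space M"
  shows "0 \<le> other_factor t \<omega> \<and> other_factor t \<omega> \<le> 1"
  unfolding other_factor_def using assms nonneg_X
  by (auto intro!: sum_nonneg mult_nonneg_nonneg)

lemma exp_sum_eq:
  "exp (- (\<Sum>j=1..n. (t(i := x)) j * X j \<omega>)) = other_factor t \<omega> * exp (- (x * X i \<omega>))"
proof -
  have "(\<Sum>j=1..n. (t(i := x)) j * X j \<omega>) = x * X i \<omega> + (\<Sum>j\<in>{1..n} - {i}. t j * X j \<omega>)"
    using i by (subst sum.remove[of _ i]) (auto intro!: sum.cong)
  then show ?thesis
    by (simp add: other_factor_def exp_add[symmetric])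
qed

lemma joint_laplace_upd:
  "joint_laplace M n X (t(i := x)) = (\<integral>\<omega>. other_factor t \<omega> * exp (- (x * X i \<omega>)) \<partial>M)"
  unfolding joint_laplace_def exp_sum_eq ..

text \<open>Integrability is recorded along with the derivative because a Bochner integral defaults
  to 0 for non-integrable functions; it makes the formula a statement about a genuine
  expectation.\<close>

lemma joint_laplace_partial_derivative:
  assumes t: "\<And>j. j \<in> {1..n} - {i} \<Longrightarrow> 0 \<le> t j" and "0 < t i"
  shows "integrable M (\<lambda>\<omega>. X i \<omega> * exp (- (\<Sum>j=1..n. t j * X j \<omega>)))"
    and "((\<lambda>x. joint_laplace M n X (t(i := x))) has_real_derivative
           - (\<integral>\<omega>. X i \<omega> * exp (- (\<Sum>j=1..n. t j * X j \<omega>)) \<partial>M)) (at (t i))"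
proof -
  \<comment> \<open>Updating \<open>t\<close> at \<open>i\<close> by its own value
    \<open>t i\<close> changes nothing, so \<open>exp_sum_eq\<close> factors the exponential at
    \<open>t\<close> itself.\<close>
  have eq: "X i \<omega> * exp (- (\<Sum>j=1..n. t j * X j \<omega>))
      = other_factor t \<omega> * (X i \<omega> * exp (- (t i * X i \<omega>)))" for \<omega>
    using exp_sum_eq[of t "t i" \<omega>] by simp
  show "integrable M (\<lambda>\<omega>. X i \<omega> * exp (- (\<Sum>j=1..n. t j * X j \<omega>)))"
    unfolding eq using assms nonneg_X i other_factor_bounds[of t]
    by (intro integrable_mult_exp_neg(2)) auto
  show "((\<lambda>x. joint_laplace M n X (t(i := x))) has_real_derivative
           - (\<integral>\<omega>. X i \<omega> * exp (- (\<Sum>j=1..n. t j * X j \<omega>)) \<partial>M)) (at (t i))"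
    unfolding eq joint_laplace_upd using assms nonneg_X i other_factor_bounds[of t]
    by (intro has_real_derivative_weighted_laplace) auto
qed

lemma joint_laplace_right_derivative:
  assumes t: "\<And>j. j \<in> {1..n} - {i} \<Longrightarrow> 0 \<le> t j"
  shows "has_right_derivative_ext (\<lambda>x. joint_laplace M n X (t(i := x)))
           (- enn2ereal (\<integral>\<^sup>+\<omega>. ennreal (other_factor t \<omega> * X i \<omega>) \<partial>M)) 0"
  unfolding joint_laplace_upd using t nonneg_X i other_factor_bounds[of t]
  by (intro has_right_derivative_ext_weighted_laplace) auto

text \<open>At the origin the other coordinates vanish, so the weight is constantly 1; the two minus
  signs cancel.\<close>

lemma diag_laplace_0: "diag_laplace M n X i 0 = enn2ereal (\<integral>\<^sup>+\<omega>. ennreal (X i \<omega>) \<partial>M)"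
  using right_derivative_ext_eqI[OF joint_laplace_right_derivative[of "\<lambda>_. 0"]]
  by (simp add: diag_laplace_def other_factor_def)

text \<open>On the diagonal the exponent collapses to a multiple of the sum. The nonnegative
  integral matches the value at 0 and can be rewritten as an integral against the allocation
  measure.\<close>

lemma diag_laplace_pos:
  assumes "0 < t"
  shows "diag_laplace M n X i t
    = enn2ereal (\<integral>\<^sup>+\<omega>. ennreal (X i \<omega> * exp (- t * rv_sum n X \<omega>)) \<partial>M)"
proof -
  have sum: "(\<Sum>j=1..n. t * X j \<omega>) = t * rv_sum n X \<omega>" for \<omega>
    by (simp add: rv_sum_def sum_distrib_left)
  note der = joint_laplace_partial_derivative[of "\<lambda>_. t", unfolded sum]
  have int: "integrable M (\<lambda>\<omega>. X i \<omega> * exp (- (t * rv_sum n X \<omega>)))"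
    using der(1) assms by simp
  have "diag_laplace M n X i t = ereal (\<integral>\<omega>. X i \<omega> * exp (- (t * rv_sum n X \<omega>)) \<partial>M)"
    using DERIV_imp_deriv[OF der(2)] assms by (simp add: diag_laplace_def)
  also have "\<dots> = enn2ereal (ennreal (\<integral>\<omega>. X i \<omega> * exp (- (t * rv_sum n X \<omega>)) \<partial>M))"
    using nonneg_X i by (subst enn2ereal_ennreal) (auto intro!: integral_nonneg_AE AE_I2)
  also have "\<dots> = enn2ereal (\<integral>\<^sup>+\<omega>. ennreal (X i \<omega> * exp (- (t * rv_sum n X \<omega>))) \<partial>M)"
    using nonneg_X i by (subst nn_integral_eq_integral[OF int]) auto
  finally show ?thesis by simp
qed

section \<open>Density of the allocation measure and conditional expectation\<close>

lemma sets_law_sum [simp]: "sets (law_sum M n X) = sets borel"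
  by (simp add: law_sum_def)

lemma sets_alloc_measure [simp]: "sets (alloc_measure M n X i) = sets borel"
  by (subst alloc_measure_eq_distr[OF measurable_X i]) auto

lemma emeasure_alloc:
  "B \<in> sets borel \<Longrightarrow> emeasure (alloc_measure M n X i) B
     = (\<integral>\<^sup>+\<omega>. ennreal (X i \<omega>) * indicator B (rv_sum n X \<omega>) \<partial>M)"
  by (rule emeasure_alloc_measure[OF measurable_X i])

text \<open>Change of variables: the allocation measure is the image under the sum of
  \<open>M\<close> weighted by \<open>X i\<close>.\<close>

lemma nn_integral_alloc_measure:
  assumes [measurable]: "h \<in> borel_measurable borel"
  shows "(\<integral>\<^sup>+s. h s \<partial>alloc_measure M n X i) = (\<integral>\<^sup>+\<omega>. ennreal (X i \<omega>) * h (rv_sum n X \<omega>) \<partial>M)"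
proof -
  have "alloc_measure M n X i = distr (density M (\<lambda>\<omega>. ennreal (X i \<omega>))) borel (rv_sum n X)"
    by (rule alloc_measure_eq_distr[OF measurable_X i])
  then show ?thesis
    by (simp add: nn_integral_distr nn_integral_density)
qed

text \<open>If the sum almost surely avoids \<open>B\<close>, then \<open>X i\<close> times the
  indicator of that event vanishes almost surely.\<close>

lemma absolutely_continuous_alloc_measure:
  "absolutely_continuous (law_sum M n X) (alloc_measure M n X i)"
  unfolding absolutely_continuous_def
proof
  fix B assume "B \<in> null_sets (law_sum M n X)"
  then have [measurable]: "B \<in> sets borel" and "AE s in law_sum M n X. s \<notin> B"
    by (auto intro: AE_not_in)
  then have "AE \<omega> in M. rv_sum n X \<omega> \<notin> B"
    unfolding law_sum_def by (subst (asm) AE_distr_iff) auto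
  then have "(\<integral>\<^sup>+\<omega>. ennreal (X i \<omega>) * indicator B (rv_sum n X \<omega>) \<partial>M) = 0"
    by (subst nn_integral_0_iff_AE) auto
  then show "B \<in> null_sets (alloc_measure M n X i)"
    by (simp add: null_sets_def emeasure_alloc)
qed

text \<open>The reference measure is a probability measure, so Radon-Nikodym applies even when
  \<open>X i\<close> has infinite mean and the allocation measure infinite mass.\<close>

lemma is_density_of_RN_deriv:
  "is_density_of (alloc_measure M n X i) (law_sum M n X)
     (RN_deriv (law_sum M n X) (alloc_measure M n X i))"
proof -
  interpret law: prob_space "law_sum M n X"
    unfolding law_sum_def by (rule prob_space_distr) simp
  show ?thesis
    unfolding is_density_of_def
    using law.density_RN_deriv[OF absolutely_continuous_alloc_measure] by simp
qed

lemma is_density_of_borel_measurable: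
  "is_density_of (alloc_measure M n X i) (law_sum M n X) m \<Longrightarrow> m \<in> borel_measurable borel"
  unfolding is_density_of_def by (simp cong: measurable_cong_sets)

text \<open>\<open>m (rv_sum n X \<omega>)\<close> is measurable for the sigma-algebra generated by
  the sum and has the same integral as \<open>X i\<close> over each of its events, which
  characterises the conditional expectation.\<close>

lemma cond_exp_given_eq_density:
  assumes m: "is_density_of (alloc_measure M n X i) (law_sum M n X) m"
  shows "AE \<omega> in M. m (rv_sum n X \<omega>) = cond_exp_given M (X i) (rv_sum n X) \<omega>"
proof -
  let ?S = "rv_sum n X"
  let ?F = "vimage_algebra (space M) ?S borel"
  have m_meas [measurable]: "m \<in> borel_measurable borel"
    using m by (rule is_density_of_borel_measurable)
  have sub: "subalgebra M ?F"
    unfolding subalgebra_def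
    by (auto simp: sets_vimage_algebra2 intro!: measurable_sets[OF measurable_rv_sum])
  interpret F: finite_measure_subalgebra M ?F
    by unfold_locales (rule sub)
  have "?S \<in> measurable ?F borel"
    by (rule measurable_vimage_algebra1) auto
  then have "(\<lambda>\<omega>. m (?S \<omega>)) \<in> borel_measurable ?F"
    by measurable
  \<comment> \<open>Such an event is the preimage of a Borel set \<open>B\<close>, and both
    integrals equal the allocation measure of \<open>B\<close>.\<close>
  moreover have "(\<integral>\<^sup>+\<omega>\<in>A. ennreal (X i \<omega>) \<partial>M) = (\<integral>\<^sup>+\<omega>\<in>A. m (?S \<omega>) \<partial>M)" if "A \<in> sets ?F" for A
  proof -
    from that obtain B where [measurable]: "B \<in> sets borel" and A: "A = ?S -` B \<inter> space M"
      by (auto simp: sets_vimage_algebra2)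
    have ind: "(\<integral>\<^sup>+\<omega>\<in>A. h \<omega> \<partial>M) = (\<integral>\<^sup>+\<omega>. h \<omega> * indicator B (?S \<omega>) \<partial>M)" for h
      by (intro nn_integral_cong) (auto simp: A indicator_def)
    have "(\<integral>\<^sup>+\<omega>. ennreal (X i \<omega>) * indicator B (?S \<omega>) \<partial>M)
        = emeasure (density (law_sum M n X) m) B"
      using m by (simp add: emeasure_alloc is_density_of_def)
    also have "\<dots> = (\<integral>\<^sup>+\<omega>. m (?S \<omega>) * indicator B (?S \<omega>) \<partial>M)"
      unfolding law_sum_def by (simp add: emeasure_density nn_integral_distr)
    finally show ?thesis
      by (simp only: ind)
  qed
  ultimately show ?thesis
    unfolding cond_exp_given_def by (intro F.nn_cond_exp_charact) auto
qed

text \<open>Both functions agree almost surely when evaluated at the sum, and the law of the sum is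
  the image measure.\<close>

lemma cond_exp_at_version_eq_density:
  assumes m: "is_density_of (alloc_measure M n X i) (law_sum M n X) m"
    and g: "cond_exp_at_version M (X i) (rv_sum n X) g"
  shows "AE s in law_sum M n X. g s = m s"
proof -
  have [measurable]: "m \<in> borel_measurable borel" "g \<in> borel_measurable borel"
    using is_density_of_borel_measurable[OF m] g by (auto simp: cond_exp_at_version_def)
  have "AE \<omega> in M. g (rv_sum n X \<omega>) = cond_exp_given M (X i) (rv_sum n X) \<omega>"
    using g by (simp add: cond_exp_at_version_def)
  with cond_exp_given_eq_density[OF m] have "AE \<omega> in M. g (rv_sum n X \<omega>) = m (rv_sum n X \<omega>)"
    by eventually_elim simp
  then show ?thesis
    unfolding law_sum_def by (subst AE_distr_iff) auto
qed

section \<open>Lebesgue densities and their Laplace transforms\<close>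

lemma is_density_of_lborel:
  assumes f: "distributed M lborel (rv_sum n X) f"
    and m: "is_density_of (alloc_measure M n X i) (law_sum M n X) m"
  shows "is_density_of (alloc_measure M n X i) lborel (\<lambda>s. f s * m s)"
proof -
  have [measurable]: "m \<in> borel_measurable borel" "f \<in> borel_measurable borel"
    using is_density_of_borel_measurable[OF m] f by (auto simp: distributed_def)
  \<comment> \<open>\<open>distributed\<close> takes the image measure with target
    \<open>lborel\<close>, \<open>law_sum\<close> with target \<open>borel\<close>; only the
    sigma-algebra of the target matters.\<close>
  have "law_sum M n X = density lborel f"
    using f unfolding distributed_def law_sum_def by (metis distr_cong sets_lborel)
  then show ?thesis
    using m by (simp add: is_density_of_def density_density_eq)
qed

lemma lborel_density_eq_cond_exp:
  assumes f: "distributed M lborel (rv_sum n X) f"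
    and \<xi>: "is_density_of (alloc_measure M n X i) lborel \<xi>"
    and g: "cond_exp_at_version M (X i) (rv_sum n X) g"
  shows "AE s in lborel. \<xi> s = g s * f s"
proof -
  let ?m = "RN_deriv (law_sum M n X) (alloc_measure M n X i)"
  have f_meas [measurable]: "f \<in> borel_measurable lborel"
    using f by (auto simp: distributed_def)
  have law: "law_sum M n X = density lborel f"
    using f unfolding distributed_def law_sum_def by (metis distr_cong sets_lborel)
  have "AE s in lborel. \<xi> s = f s * ?m s"
    using \<xi> is_density_of_lborel[OF f is_density_of_RN_deriv]
    by (intro sigma_finite_measure.density_unique_iff[OF lborel.sigma_finite_measure_axioms, THEN iffD1]) (auto simp: is_density_of_def)
  \<comment> \<open>Agreement almost everywhere for the law gives Lebesgue-almost everywhere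
    agreement only where \<open>f\<close> is positive. Where \<open>f\<close> is 0 both products
    vanish, also at infinite values.\<close>
  moreover have "AE s in lborel. 0 < f s \<longrightarrow> g s = ?m s"
    using cond_exp_at_version_eq_density[OF is_density_of_RN_deriv g]
    by (simp only: law AE_density[OF f_meas])
  ultimately show ?thesis
    by eventually_elim (auto simp: mult.commute zero_less_iff_neq_zero)
qed

lemma diag_laplace_eq_laplace_density:
  assumes \<xi>: "is_density_of (alloc_measure M n X i) lborel \<xi>" and "0 < t"
  shows "diag_laplace M n X i t
    = enn2ereal (\<integral>\<^sup>+s\<in>{0..}. (ennreal (exp (- t * s)) * \<xi> s) \<partial>lborel)"
proof -
  have [measurable]: "\<xi> \<in> borel_measurable borel" and d: "density lborel \<xi> = alloc_measure M n X i"
    using \<xi> by (auto simp: is_density_of_def)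
  \<comment> \<open>The restriction to the half-line is moved into the test function; it disappears
    after the change of variables because the sum is nonnegative.\<close>
  let ?h = "\<lambda>s. ennreal (exp (- t * s)) * indicator {0..} s"
  have "(\<integral>\<^sup>+s\<in>{0..}. (ennreal (exp (- t * s)) * \<xi> s) \<partial>lborel) = (\<integral>\<^sup>+s. ?h s \<partial>density lborel \<xi>)"
    by (subst nn_integral_density) (auto intro!: nn_integral_cong simp: mult_ac)
  also have "\<dots> = (\<integral>\<^sup>+\<omega>. ennreal (X i \<omega>) * ?h (rv_sum n X \<omega>) \<partial>M)"
    unfolding d by (rule nn_integral_alloc_measure) measurable
  also have "\<dots> = (\<integral>\<^sup>+\<omega>. ennreal (X i \<omega> * exp (- t * rv_sum n X \<omega>)) \<partial>M)"
    using nonneg_X i rv_sum_nonneg by (intro nn_integral_cong) (auto simp: ennreal_mult)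
  finally show ?thesis
    using diag_laplace_pos[OF \<open>0 < t\<close>] by simp
qed

end

theorem theorem1:
  fixes M :: "'a measure" and n i :: nat and X :: "nat \<Rightarrow> 'a \<Rightarrow> real"
  assumes "prob_space M"
    and "\<And>j. j \<in> {1..n} \<Longrightarrow> X j \<in> borel_measurable M"
    and "\<And>j \<omega>. j \<in> {1..n} \<Longrightarrow> \<omega> \<in> space M \<Longrightarrow> 0 \<le> X j \<omega>"
    and "i \<in> {1..n}"
  shows
    "((\<forall>t. (\<forall>j\<in>{1..n}. 0 \<le> t j) \<longrightarrow>
        (0 < t i \<longrightarrow>
           integrable M (\<lambda>\<omega>. X i \<omega> * exp (- (\<Sum>j=1..n. t j * X j \<omega>))) \<and>
           ((\<lambda>x. joint_laplace M n X (t(i := x))) has_real_derivative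
              - (\<integral>\<omega>. X i \<omega> * exp (- (\<Sum>j=1..n. t j * X j \<omega>)) \<partial>M)) (at (t i))) \<and>
        (t i = 0 \<longrightarrow>
           (\<exists>D. D < \<infinity> \<and>
              has_right_derivative_ext (\<lambda>x. joint_laplace M n X (t(i := x))) D 0))) \<and>
      diag_laplace M n X i 0 = enn2ereal (\<integral>\<^sup>+\<omega>. ennreal (X i \<omega>) \<partial>M) \<and>
      (\<forall>t>0. diag_laplace M n X i t =
         enn2ereal (\<integral>\<^sup>+\<omega>. ennreal (X i \<omega> * exp (- t * rv_sum n X \<omega>)) \<partial>M)))
     \<and>
     (is_density_of (alloc_measure M n X i) (law_sum M n X)
        (RN_deriv (law_sum M n X) (alloc_measure M n X i)) \<and>
      (\<forall>m. is_density_of (alloc_measure M n X i) (law_sum M n X) m \<longrightarrow>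
         (AE \<omega> in M. m (rv_sum n X \<omega>) = cond_exp_given M (X i) (rv_sum n X) \<omega>) \<and>
         (\<forall>g. cond_exp_at_version M (X i) (rv_sum n X) g \<longrightarrow>
            (AE s in law_sum M n X. g s = m s))))
     \<and>
     (\<forall>f. distributed M lborel (rv_sum n X) f \<longrightarrow>
        (\<exists>\<xi>. is_density_of (alloc_measure M n X i) lborel \<xi>) \<and>
        (\<forall>\<xi>. is_density_of (alloc_measure M n X i) lborel \<xi> \<longrightarrow>
           (\<forall>g. cond_exp_at_version M (X i) (rv_sum n X) g \<longrightarrow>
              (AE s in lborel. 0 < s \<longrightarrow> \<xi> s = g s * f s)) \<and>
           (\<forall>t>0. diag_laplace M n X i t =
              enn2ereal (\<integral>\<^sup>+s\<in>{0..}. (ennreal (exp (- t * s)) * \<xi> s) \<partial>lborel))))"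
proof -
  interpret nonneg_summands M n i X
    using assms by (simp add: nonneg_summands_def nonneg_summands_axioms_def)
  have right: "\<exists>D. D < \<infinity> \<and> has_right_derivative_ext (\<lambda>x. joint_laplace M n X (t(i := x))) D 0"
    if "\<forall>j\<in>{1..n}. 0 \<le> t j" for t
  proof (intro exI conjI)
    show "has_right_derivative_ext (\<lambda>x. joint_laplace M n X (t(i := x)))
        (- enn2ereal (\<integral>\<^sup>+\<omega>. ennreal (other_factor t \<omega> * X i \<omega>) \<partial>M)) 0"
      using that by (intro joint_laplace_right_derivative) auto
    \<comment> \<open>The negative of a nonnegative extended real is at most 0, so only the value
      minus infinity remains possible besides finite ones.\<close>
    show "- enn2ereal (\<integral>\<^sup>+\<omega>. ennreal (other_factor t \<omega> * X i \<omega>) \<partial>M) < \<infinity>"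
      using enn2ereal_nonneg[of "\<integral>\<^sup>+\<omega>. ennreal (other_factor t \<omega> * X i \<omega>) \<partial>M"]
      by (auto simp: ereal_uminus_eq_reorder simp flip: less_top)
  qed
  have partial: "integrable M (\<lambda>\<omega>. X i \<omega> * exp (- (\<Sum>j=1..n. t j * X j \<omega>)))"
      "((\<lambda>x. joint_laplace M n X (t(i := x))) has_real_derivative
         - (\<integral>\<omega>. X i \<omega> * exp (- (\<Sum>j=1..n. t j * X j \<omega>)) \<partial>M)) (at (t i))"
    if "\<forall>j\<in>{1..n}. 0 \<le> t j" "0 < t i" for t
    using joint_laplace_partial_derivative[of t] that by auto
  have ex: "\<exists>\<xi>. is_density_of (alloc_measure M n X i) lborel \<xi>"
    if "distributed M lborel (rv_sum n X) f" for f
    using is_density_of_lborel[OF that is_density_of_RN_deriv] by blast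
  have AE: "AE s in lborel. 0 < s \<longrightarrow> \<xi> s = g s * f s"
    if "distributed M lborel (rv_sum n X) f" "is_density_of (alloc_measure M n X i) lborel \<xi>"
      "cond_exp_at_version M (X i) (rv_sum n X) g" for f \<xi> g
    using lborel_density_eq_cond_exp[OF that] by eventually_elim simp
  show ?thesis
    by (intro conjI allI impI; rule partial right diag_laplace_0 diag_laplace_pos
        is_density_of_RN_deriv cond_exp_given_eq_density cond_exp_at_version_eq_density
        ex AE diag_laplace_eq_laplace_density; assumption)
qed

end
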